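(* Let $f:\mathbb{R}^n\to\mathbb{R}$ be convex and $L_f$-smooth, $\rho>0$, $x_k\in\mathbb{R}^n$, and let $(y_i)_{i\in\mathcal{I}_j}$ be a finite nonempty family of points of $\mathbb{R}^n$. The nonconvex quadratically constrained quadratic program $$\min_{t\in\mathbb{R},\,y\in\mathbb{R}^n,\,u\in\mathbb{R}^n}\ t+\frac{\rho}{2}\|y-x_k\|^2$$ subject to, for all $i\in\mathcal{I}_j$, $$t-f(y_i)-\langle\nabla f(y_i),y-y_i\rangle\ge\frac{1}{2L_f}\|u-\nabla f(y_i)\|^2,\qquad f(y_i)-t-\langle u,y_i-y\rangle\ge\frac{1}{2L_f}\|u-\nabla f(y_i)\|^2,$$ is equivalent to the convex quadratically constrained quadratic program $$\min_{t\in\mathbb{R},\,y\in\mathbb{R}^n}\ t+\frac{\rho}{2}\|y-x_k\|^2\quad\text{s.t.}\quad t-f(y_i)-\langle\nabla f(y_i),y-y_i\rangle\ge\frac{\rho^2}{2L_f}\Big\|y-x_k+\frac1\rho\nabla f(y_i)\Big\|^2\quad\forall i\in\mathcal{I}_j.$$ That is, the two problems have the same optimal value, and $(t,y)$ is optimal for the convex program if and only if $(t,y,u)$ is optimal for the nonconvex program for some $u\in\mathbb{R}^n$.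
   Context: A function is $L_f$-smooth if it is differentiable with $\|\nabla f(y)-\nabla f(x)\|\le L_f\|x-y\|$ for all $x,y\in\mathbb{R}^n$ (Euclidean norm, $L_f>0$). *)

theory Defs
  imports "HOL-Analysis.Analysis"
begin

text \<open>The gradient is specified only at points of differentiability, where it is unique.\<close>

definition grad :: "('a::euclidean_space \<Rightarrow> real) \<Rightarrow> 'a \<Rightarrow> 'a" where
  "grad f x = (THE D. GDERIV f x :> D)"

lemma GDERIV_grad:
  fixes f :: "'a::euclidean_space \<Rightarrow> real"
  assumes "f differentiable (at x)"
  shows "GDERIV f x :> grad f x"
proof -
  obtain A where A: "(f has_derivative A) (at x)"
    using assms unfolding differentiable_def by blast
  interpret A: bounded_linear A
    using A by (rule has_derivative_bounded_linear)
  have "A = (\<lambda>h. h \<bullet> adjoint A 1)"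
    using adjoint_works[OF A.linear, of _ 1] by (simp add: fun_eq_iff)
  then have ex: "GDERIV f x :> adjoint A 1"
    using A unfolding gderiv_def by simp
  show ?thesis
    unfolding grad_def
  proof (rule theI, rule ex)
    fix D assume "GDERIV f x :> D"
    then have "(\<lambda>h. h \<bullet> D) = (\<lambda>h. h \<bullet> adjoint A 1)"
      using ex unfolding gderiv_def by (rule has_derivative_unique)
    then show "D = adjoint A 1"
      using vector_eq_ldot[of D "adjoint A 1"] by (simp add: fun_eq_iff)
  qed
qed

definition L_smooth :: "real \<Rightarrow> ('a::euclidean_space \<Rightarrow> real) \<Rightarrow> bool" where
  "L_smooth L f \<longleftrightarrow> L > 0 \<and> (\<forall>x. f differentiable (at x)) \<and>
     (\<forall>x y. norm (grad f y - grad f x) \<le> L * norm (x - y))"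

text \<open>The optimal value is
  taken in the extended reals, so that it is meaningful without assuming that the infimum is
  finite.\<close>

definition optimal_value :: "('z \<Rightarrow> real) \<Rightarrow> 'z set \<Rightarrow> ereal" where
  "optimal_value \<phi> S = (INF z\<in>S. ereal (\<phi> z))"

definition nonconvex_objective ::
    "real \<Rightarrow> 'a::euclidean_space \<Rightarrow> real \<times> 'a \<times> 'a \<Rightarrow> real" where
  "nonconvex_objective \<rho> xk = (\<lambda>(t, y, u). t + \<rho> / 2 * (norm (y - xk))\<^sup>2)"

definition nonconvex_feasible ::
    "('a::euclidean_space \<Rightarrow> real) \<Rightarrow> real \<Rightarrow> 'i set \<Rightarrow> ('i \<Rightarrow> 'a) \<Rightarrow> (real \<times> 'a \<times> 'a) set" where
  "nonconvex_feasible f L I p = {(t, y, u). \<forall>i\<in>I.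
     t - f (p i) - grad f (p i) \<bullet> (y - p i) \<ge> 1 / (2 * L) * (norm (u - grad f (p i)))\<^sup>2 \<and>
     f (p i) - t - u \<bullet> (p i - y) \<ge> 1 / (2 * L) * (norm (u - grad f (p i)))\<^sup>2}"

definition convex_objective :: "real \<Rightarrow> 'a::euclidean_space \<Rightarrow> real \<times> 'a \<Rightarrow> real" where
  "convex_objective \<rho> xk = (\<lambda>(t, y). t + \<rho> / 2 * (norm (y - xk))\<^sup>2)"

definition convex_feasible ::
    "('a::euclidean_space \<Rightarrow> real) \<Rightarrow> real \<Rightarrow> real \<Rightarrow> 'a \<Rightarrow> 'i set \<Rightarrow> ('i \<Rightarrow> 'a) \<Rightarrow> (real \<times> 'a) set" where
  "convex_feasible f L \<rho> xk I p = {(t, y). \<forall>i\<in>I.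
     t - f (p i) - grad f (p i) \<bullet> (y - p i)
       \<ge> \<rho>\<^sup>2 / (2 * L) * (norm (y - xk + (1 / \<rho>) *\<^sub>R grad f (p i)))\<^sup>2}"

end

theory Submission
  imports Defs
begin

text \<open>
  Write \<open>g\<^sub>i\<close> for the gradient at \<open>y\<^sub>i\<close>, and put
  \<open>c\<^sub>i = f y\<^sub>i + \<langle>g\<^sub>i, x\<^sub>k - y\<^sub>i\<rangle> + \<parallel>g\<^sub>i\<parallel>\<^sup>2 / (2 L)\<close>. The first family of
  constraints and the interpolation inequalities of \<open>f\<close> are both affine in \<open>(g\<^sub>i, c\<^sub>i)\<close>, so they
  extend to every point of the convex hull of these pairs. Let \<open>(s, c)\<close> maximise the concave
  function \<open>c - (1/\<rho> + 1/L) \<parallel>s\<parallel>\<^sup>2 / 2\<close> (the Lagrangian dual) over that hull, and call the maximum \<open>V\<close>.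
  The first constraint at \<open>(s, c)\<close> and two completions of squares show that any \<open>(t, y, u)\<close>
  satisfying the first family has objective at least
  \<open>V + \<parallel>u - s\<parallel>\<^sup>2 / (2 L) + \<rho>/2 \<parallel>y - x\<^sub>k + s/\<rho>\<parallel>\<^sup>2\<close>, which forces \<open>u = s = \<rho> (x\<^sub>k - y)\<close> at an
  optimum. Conversely, first-order optimality of \<open>(s, c)\<close> is the first family of constraints at this
  point, and the interpolation inequality at \<open>(s, c)\<close> is the second family.
\<close>

section \<open>Smooth convex functions\<close>

lemma grad_has_derivative:
  fixes f :: "'a::euclidean_space \<Rightarrow> real"
  assumes "L_smooth L f"
  shows "(f has_derivative (\<lambda>h. h \<bullet> grad f x)) (at x)"
  using GDERIV_grad[of f x] assms by (simp add: L_smooth_def gderiv_def)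

lemma DERIV_along_line:
  fixes f :: "'a::euclidean_space \<Rightarrow> real"
  assumes "L_smooth L f"
  shows "((\<lambda>r. f (x + r *\<^sub>R d)) has_real_derivative d \<bullet> grad f (x + r *\<^sub>R d)) (at r)"
proof -
  have "((\<lambda>r. x + r *\<^sub>R d) has_derivative (\<lambda>h. h *\<^sub>R d)) (at r)"
    by (auto intro!: derivative_eq_intros)
  from has_derivative_compose[OF this grad_has_derivative[OF assms]]
  show ?thesis
    by (simp add: has_field_derivative_def mult.commute[of _ "d \<bullet> _"])
qed

text \<open>Restriction to the line through \<open>x\<close> and \<open>z\<close> reduces this to
  the one-variable tangent inequality at \<open>0\<close>, evaluated at \<open>1\<close>.\<close>

lemma convex_above_tangent:
  fixes f :: "'a::euclidean_space \<Rightarrow> real"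
  assumes "convex_on UNIV f" "L_smooth L f"
  shows "f x + grad f x \<bullet> (z - x) \<le> f z"
proof -
  let ?h = "\<lambda>r. f (x + r *\<^sub>R (z - x))"
  have "convex_on UNIV ?h"
  proof (rule convex_onI)
    fix t r s :: real assume t: "0 < t" "t < 1"
    have "x + ((1 - t) *\<^sub>R r + t *\<^sub>R s) *\<^sub>R (z - x) =
        (1 - t) *\<^sub>R (x + r *\<^sub>R (z - x)) + t *\<^sub>R (x + s *\<^sub>R (z - x))"
      by (simp add: algebra_simps)
    then show "?h ((1 - t) *\<^sub>R r + t *\<^sub>R s) \<le> (1 - t) * ?h r + t * ?h s"
      using convex_onD[OF assms(1), of t] t by simp
  qed simp
  from convex_on_imp_above_tangent[OF this, of 0 1 "(z - x) \<bullet> grad f x"]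
  show ?thesis
    using DERIV_along_line[OF assms(2), of x "z - x" 0] by (simp add: inner_commute)
qed

lemma descent_lemma:
  fixes f :: "'a::euclidean_space \<Rightarrow> real"
  assumes "L_smooth L f"
  shows "f (x + d) \<le> f x + grad f x \<bullet> d + L / 2 * (norm d)\<^sup>2"
proof -
  \<comment> \<open>Subtracting the linear and quadratic terms turns the claim into
    \<open>?h 1 \<le> ?h 0\<close>; Cauchy-Schwarz and the Lipschitz bound make the derivative
    nonpositive on \<open>[0, 1]\<close>.\<close>
  let ?h = "\<lambda>r. f (x + r *\<^sub>R d) - r * (grad f x \<bullet> d) - L / 2 * r\<^sup>2 * (norm d)\<^sup>2"
  have "?h 1 \<le> ?h 0"
  proof (rule DERIV_nonpos_imp_nonincreasing[where f = ?h and a = 0 and b = 1])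
    fix r :: real assume r: "0 \<le> r" "r \<le> 1"
    let ?D = "d \<bullet> grad f (x + r *\<^sub>R d) - grad f x \<bullet> d - L * r * (norm d)\<^sup>2"
    have "(?h has_real_derivative ?D) (at r)"
      by (auto intro!: derivative_eq_intros DERIV_along_line[OF assms])
    moreover have "d \<bullet> (grad f (x + r *\<^sub>R d) - grad f x) \<le> L * r * (norm d)\<^sup>2"
    proof -
      have "norm (grad f (x + r *\<^sub>R d) - grad f x) \<le> L * norm (x - (x + r *\<^sub>R d))"
        using assms unfolding L_smooth_def by blast
      then have "norm (grad f (x + r *\<^sub>R d) - grad f x) \<le> L * (r * norm d)"
        using r by simp
      then have "norm d * norm (grad f (x + r *\<^sub>R d) - grad f x) \<le> norm d * (L * (r * norm d))"
        by (rule mult_left_mono) simp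
      with norm_cauchy_schwarz[of d "grad f (x + r *\<^sub>R d) - grad f x"]
      show ?thesis by (simp add: power2_eq_square mult_ac)
    qed
    ultimately show "\<exists>D. (?h has_real_derivative D) (at r) \<and> D \<le> 0"
      by (intro exI[of _ ?D]) (simp add: inner_diff_right inner_commute)
  qed simp
  then show ?thesis by simp
qed

lemma smooth_convex_interpolation:
  fixes f :: "'a::euclidean_space \<Rightarrow> real"
  assumes "convex_on UNIV f" "L_smooth L f"
  shows "f x + grad f x \<bullet> (z - x) + 1 / (2 * L) * (norm (grad f z - grad f x))\<^sup>2 \<le> f z"
proof -
  have L: "L > 0" using assms(2) by (simp add: L_smooth_def)
  let ?e = "grad f z - grad f x"
  \<comment> \<open>A gradient step from \<open>z\<close> for the convex function \<open>f - \<langle>grad f x, \<cdot>\<rangle>\<close>, which is minimal at \<open>x\<close>.\<close>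
  let ?w = "z + (- (1 / L)) *\<^sub>R ?e"
  have "f x + grad f x \<bullet> (?w - x) \<le> f ?w"
    by (rule convex_above_tangent[OF assms])
  also have "\<dots> \<le> f z + grad f z \<bullet> ((- (1 / L)) *\<^sub>R ?e) + L / 2 * (norm ((- (1 / L)) *\<^sub>R ?e))\<^sup>2"
    by (rule descent_lemma[OF assms(2)])
  also have "L / 2 * (norm ((- (1 / L)) *\<^sub>R ?e))\<^sup>2 = 1 / (2 * L) * (?e \<bullet> ?e)"
    using L by (simp add: power_mult_distrib power_divide dot_square_norm)
      (simp add: power2_eq_square)
  finally have "f x + grad f x \<bullet> (z - x) + 1 / L * ((grad f z - grad f x) \<bullet> ?e)
      \<le> f z + 1 / (2 * L) * (?e \<bullet> ?e)"
    by (simp add: inner_diff_left inner_diff_right inner_add_right algebra_simps diff_divide_distrib)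
  moreover have "1 / L * (?e \<bullet> ?e) = 2 * (1 / (2 * L) * (?e \<bullet> ?e))"
    using L by simp
  ultimately show ?thesis
    by (simp add: power2_norm_eq_inner)
qed

section \<open>The dual maximiser\<close>

text \<open>The bound describes a halfspace with normal \<open>(v, 1)\<close>, which is convex. This
  carries inequalities from the data pairs to the dual maximiser.\<close>

lemma affine_le_convex_hull:
  fixes s v :: "'a::euclidean_space" and c b :: real
  assumes "(s, c) \<in> convex hull S" "\<And>g d. (g, d) \<in> S \<Longrightarrow> d + v \<bullet> g \<le> b"
  shows "c + v \<bullet> s \<le> b"
proof -
  have "convex hull S \<subseteq> {z. (v, 1) \<bullet> z \<le> b}"
    by (rule hull_minimal) (auto simp: convex_halfspace_le add.commute dest: assms(2))
  with assms(1) show ?thesis by auto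
qed

text \<open>A maximiser of \<open>d - \<kappa> / 2 * (g \<bullet> g)\<close> exists by compactness;
  the inequality is its first-order condition, obtained by moving a fraction \<open>r\<close>
  towards \<open>(g, d)\<close> and letting \<open>r\<close> tend to \<open>0\<close>.\<close>

lemma concave_quadratic_maximiser:
  fixes K :: "('a::euclidean_space \<times> real) set"
  assumes "compact K" "convex K" "K \<noteq> {}"
  obtains s c where "(s, c) \<in> K"
    "\<And>g d. (g, d) \<in> K \<Longrightarrow> d - \<kappa> * (s \<bullet> g) \<le> c - \<kappa> * (s \<bullet> s)"
proof -
  let ?\<phi> = "\<lambda>z::'a \<times> real. snd z - \<kappa> / 2 * (fst z \<bullet> fst z)"
  have "continuous_on K ?\<phi>" by (intro continuous_intros)
  from continuous_attains_sup[OF assms(1,3) this]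
  obtain s c where sc: "(s, c) \<in> K" and max: "\<And>z. z \<in> K \<Longrightarrow> ?\<phi> z \<le> ?\<phi> (s, c)"
    by (metis surj_pair)
  have "d - \<kappa> * (s \<bullet> g) \<le> c - \<kappa> * (s \<bullet> s)" if gd: "(g, d) \<in> K" for g d
  proof -
    \<comment> \<open>Along the segment the objective changes by exactly
      \<open>r * a - r * (r * q)\<close>.\<close>
    define a where "a = d - c - \<kappa> * (s \<bullet> (g - s))"
    define q where "q = \<kappa> / 2 * ((g - s) \<bullet> (g - s))"
    have step: "a \<le> r * q" if r: "0 < r" "r < 1" for r
    proof -
      have "(1 - r) *\<^sub>R (s, c) + r *\<^sub>R (g, d) \<in> K"
        using assms(2) sc gd r by (intro convexD) auto
      moreover have "(1 - r) *\<^sub>R (s, c) + r *\<^sub>R (g, d) = (s + r *\<^sub>R (g - s), c + r * (d - c))"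
        by (simp add: algebra_simps)
      ultimately have "?\<phi> (s + r *\<^sub>R (g - s), c + r * (d - c)) \<le> ?\<phi> (s, c)"
        using max by metis
      then have "r * a \<le> r * (r * q)"
        unfolding a_def q_def
        by (simp add: inner_add_left inner_add_right inner_diff_left inner_diff_right
            inner_commute algebra_simps)
      then show ?thesis using r by simp
    qed
    have "eventually (\<lambda>r. a \<le> r * q) (at_right 0)"
      using eventually_at_right_less[of "0::real"] eventually_at_right_field[of _ "0::real"]
      by (auto intro: step exI[of _ 1])
    moreover have "((\<lambda>r. r * q) \<longlongrightarrow> 0 * q) (at_right 0)"
      by (intro tendsto_intros)
    ultimately have "a \<le> 0 * q"
      by (intro tendsto_lowerbound) auto
    then show ?thesis by (simp add: a_def inner_diff_right algebra_simps)
  qed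
  with sc that show thesis by blast
qed

text \<open>Completing squares in \<open>u\<close> and in \<open>y - xk\<close> gives the bound.
  Both squares are kept, since the one in \<open>y\<close> later yields uniqueness.\<close>

lemma dual_lower_bound:
  fixes s y u xk :: "'a::euclidean_space"
  assumes "L > 0" "\<rho> > 0"
    and "c + (y - xk - (1 / L) *\<^sub>R u) \<bullet> s \<le> t - 1 / (2 * L) * (u \<bullet> u)"
  shows "c - (1 / \<rho> + 1 / L) / 2 * (s \<bullet> s) + 1 / (2 * L) * (norm (u - s))\<^sup>2
      + \<rho> / 2 * (norm (y - xk + (1 / \<rho>) *\<^sub>R s))\<^sup>2
    \<le> t + \<rho> / 2 * (norm (y - xk))\<^sup>2"
proof -
  define w where "w = y - xk"
  have "c + w \<bullet> s - 1 / L * (u \<bullet> s) \<le> t - 1 / (2 * L) * (u \<bullet> u)"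
    using assms(3) by (simp add: w_def inner_diff_left)
  moreover have "\<rho> / 2 * (norm (w + (1 / \<rho>) *\<^sub>R s))\<^sup>2
      = \<rho> / 2 * (norm w)\<^sup>2 + w \<bullet> s + 1 / (2 * \<rho>) * (s \<bullet> s)"
    using assms(2) unfolding power2_norm_eq_inner
    by (simp add: inner_add_left inner_add_right inner_commute field_simps)
  moreover have "1 / (2 * L) * (norm (u - s))\<^sup>2
      = 1 / (2 * L) * (u \<bullet> u) - 1 / L * (u \<bullet> s) + 1 / (2 * L) * (s \<bullet> s)"
    using assms(1) unfolding power2_norm_eq_inner
    by (simp add: inner_diff_left inner_diff_right inner_commute field_simps)
  moreover have "(1 / \<rho> + 1 / L) / 2 * (s \<bullet> s) = 1 / (2 * \<rho>) * (s \<bullet> s) + 1 / (2 * L) * (s \<bullet> s)"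
    by (simp add: field_simps)
  ultimately show ?thesis unfolding w_def[symmetric] by linarith
qed

section \<open>The common optimum\<close>

text \<open>Expanding the square puts \<open>g \<bullet> g\<close> into the constant; what remains
  is affine in \<open>g\<close> and that constant.\<close>

lemma cut_iff_affine:
  fixes g q :: "'a::euclidean_space"
  assumes "L > 0"
  shows "1 / (2 * L) * (norm (u - g))\<^sup>2 \<le> t - a - g \<bullet> (y - q) \<longleftrightarrow>
    (a + g \<bullet> (xk - q) + 1 / (2 * L) * (g \<bullet> g)) + (y - xk - (1 / L) *\<^sub>R u) \<bullet> g
      \<le> t - 1 / (2 * L) * (u \<bullet> u)"
proof -
  have "1 / (2 * L) * (norm (u - g))\<^sup>2
      = 1 / (2 * L) * (u \<bullet> u) - 1 / L * (u \<bullet> g) + 1 / (2 * L) * (g \<bullet> g)"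
    using assms unfolding power2_norm_eq_inner
    by (simp add: inner_diff_left inner_diff_right inner_commute field_simps)
  moreover have "(y - xk - (1 / L) *\<^sub>R u) \<bullet> g = g \<bullet> y - g \<bullet> xk - 1 / L * (u \<bullet> g)"
    by (simp add: inner_diff_left inner_diff_right inner_commute)
  ultimately show ?thesis by (simp only: inner_diff_right) linarith
qed

text \<open>The convex constraints are the first nonconvex family with \<open>u\<close> eliminated
  by \<open>u = \<rho> *\<^sub>R (xk - y)\<close>.\<close>

lemma convex_feasible_iff_cuts:
  fixes xk :: "'a::euclidean_space"
  assumes "\<rho> > 0"
  shows "(t, y) \<in> convex_feasible f L \<rho> xk I p \<longleftrightarrow>
    (\<forall>i\<in>I. 1 / (2 * L) * (norm (\<rho> *\<^sub>R (xk - y) - grad f (p i)))\<^sup>2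
      \<le> t - f (p i) - grad f (p i) \<bullet> (y - p i))"
proof -
  have "\<rho>\<^sup>2 / (2 * L) * (norm (y - xk + (1 / \<rho>) *\<^sub>R g))\<^sup>2
      = 1 / (2 * L) * (norm (\<rho> *\<^sub>R (xk - y) - g))\<^sup>2" for g
  proof -
    have "\<rho> *\<^sub>R (xk - y) - g = (- \<rho>) *\<^sub>R (y - xk + (1 / \<rho>) *\<^sub>R g)"
      using assms by (simp add: algebra_simps)
    then have "(norm (\<rho> *\<^sub>R (xk - y) - g))\<^sup>2 = \<rho>\<^sup>2 * (norm (y - xk + (1 / \<rho>) *\<^sub>R g))\<^sup>2"
      by (simp only: norm_scaleR power_mult_distrib) simp
    then show ?thesis by simp
  qed
  then show ?thesis
    by (simp only: convex_feasible_def mem_Collect_eq case_prod_conv)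
qed

text \<open>The last claim assumes only the first family, for arbitrary \<open>u\<close>, so it
  bounds both programs and makes their optimal \<open>(t, y)\<close> unique.\<close>

lemma common_optimum:
  fixes f :: "'a::euclidean_space \<Rightarrow> real"
  assumes "convex_on UNIV f" "L_smooth L f" "\<rho> > 0" "finite I" "I \<noteq> {}"
  obtains t0 y0 u0 where
    "(t0, y0) \<in> convex_feasible f L \<rho> xk I p"
    "(t0, y0, u0) \<in> nonconvex_feasible f L I p"
    "\<And>t y u. (\<And>i. i \<in> I \<Longrightarrow>
        1 / (2 * L) * (norm (u - grad f (p i)))\<^sup>2 \<le> t - f (p i) - grad f (p i) \<bullet> (y - p i)) \<Longrightarrow>
      t0 + \<rho> / 2 * (norm (y0 - xk))\<^sup>2 \<le> t + \<rho> / 2 * (norm (y - xk))\<^sup>2 \<and>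
      (t + \<rho> / 2 * (norm (y - xk))\<^sup>2 \<le> t0 + \<rho> / 2 * (norm (y0 - xk))\<^sup>2 \<longrightarrow> t = t0 \<and> y = y0)"
proof -
  have L: "L > 0" using assms(2) by (simp add: L_smooth_def)
  define g where "g i = grad f (p i)" for i
  define d where "d i = f (p i) + g i \<bullet> (xk - p i) + 1 / (2 * L) * (g i \<bullet> g i)" for i
  define S where "S = (\<lambda>i. (g i, d i)) ` I"
  define \<kappa> where "\<kappa> = 1 / \<rho> + 1 / L"
  have cut_iff: "1 / (2 * L) * (norm (u - g i))\<^sup>2 \<le> t - f (p i) - g i \<bullet> (y - p i) \<longleftrightarrow>
      d i + (y - xk - (1 / L) *\<^sub>R u) \<bullet> g i \<le> t - 1 / (2 * L) * (u \<bullet> u)" for t y u i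
    unfolding d_def by (rule cut_iff_affine[OF L])
  have "compact (convex hull S)" "convex (convex hull S)" "convex hull S \<noteq> {}"
    using assms(4,5) by (simp_all add: S_def compact_convex_hull finite_imp_compact)
  from concave_quadratic_maximiser[OF this, of \<kappa>] obtain s c where
    sc: "(s, c) \<in> convex hull S" and
    opt: "\<And>g d. (g, d) \<in> convex hull S \<Longrightarrow> d - \<kappa> * (s \<bullet> g) \<le> c - \<kappa> * (s \<bullet> s)"
    by blast
  have hull: "c + v \<bullet> s \<le> b" if "\<And>i. i \<in> I \<Longrightarrow> d i + v \<bullet> g i \<le> b" for v b
    using affine_le_convex_hull[OF sc, of v b] that by (auto simp: S_def)
  \<comment> \<open>This \<open>y0\<close> makes the \<open>y\<close> square of
    \<open>dual_lower_bound\<close> vanish, and \<open>t0\<close> turns the first family at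
    \<open>u = s\<close> into the optimality condition \<open>opt\<close>.\<close>
  define y0 where "y0 = xk - (1 / \<rho>) *\<^sub>R s"
  define t0 where "t0 = c - \<kappa> * (s \<bullet> s) + 1 / (2 * L) * (s \<bullet> s)"
  have y0: "y0 - xk = - ((1 / \<rho>) *\<^sub>R s)" "\<rho> *\<^sub>R (xk - y0) = s"
    using assms(3) by (simp_all add: y0_def)
  \<comment> \<open>No duality gap: the primal objective at \<open>(t0, y0)\<close> is the dual
    maximum.\<close>
  have val: "t0 + \<rho> / 2 * (norm (y0 - xk))\<^sup>2 = c - \<kappa> / 2 * (s \<bullet> s)"
    using assms(3) unfolding t0_def y0 \<kappa>_def power2_norm_eq_inner
    by (simp add: field_simps power2_eq_square)
  have cut0: "1 / (2 * L) * (norm (s - g i))\<^sup>2 \<le> t0 - f (p i) - g i \<bullet> (y0 - p i)"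
    if "i \<in> I" for i
  proof -
    have "(g i, d i) \<in> convex hull S"
      using that by (intro hull_inc) (auto simp: S_def)
    from opt[OF this] have "d i - \<kappa> * (s \<bullet> g i) \<le> c - \<kappa> * (s \<bullet> s)" .
    moreover have "(y0 - xk - (1 / L) *\<^sub>R s) \<bullet> g i = - \<kappa> * (s \<bullet> g i)"
      unfolding y0 \<kappa>_def by (simp add: inner_diff_left algebra_simps)
    ultimately show ?thesis unfolding cut_iff t0_def by linarith
  qed
  have second0: "1 / (2 * L) * (norm (s - g i))\<^sup>2 \<le> f (p i) - t0 - s \<bullet> (p i - y0)" for i
  proof -
    have "c + (p i - xk - (1 / L) *\<^sub>R g i) \<bullet> s \<le> f (p i) - 1 / (2 * L) * (g i \<bullet> g i)"
    proof (rule hull)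
      \<comment> \<open>Interpolation between \<open>p j\<close> and \<open>p i\<close> is the first
        constraint of index \<open>j\<close> at the triple \<open>(f (p i), p i, g i)\<close>, so
        \<open>cut_iff\<close> applies to it.\<close>
      fix j assume "j \<in> I"
      have "1 / (2 * L) * (norm (g i - g j))\<^sup>2 \<le> f (p i) - f (p j) - g j \<bullet> (p i - p j)"
        using smooth_convex_interpolation[OF assms(1,2), of "p j" "p i"] by (simp add: g_def)
      then show "d j + (p i - xk - (1 / L) *\<^sub>R g i) \<bullet> g j \<le> f (p i) - 1 / (2 * L) * (g i \<bullet> g i)"
        by (simp only: cut_iff)
    qed
    moreover have "(p i - xk - (1 / L) *\<^sub>R g i) \<bullet> s = s \<bullet> (p i - xk) - 1 / L * (s \<bullet> g i)"
      by (simp add: inner_diff_left inner_diff_right inner_commute)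
    moreover have "s \<bullet> (p i - y0) = s \<bullet> (p i - xk) + 1 / \<rho> * (s \<bullet> s)"
      by (simp add: y0_def inner_diff_right)
    moreover have "1 / (2 * L) * (norm (s - g i))\<^sup>2
        = 1 / (2 * L) * (s \<bullet> s) - 1 / L * (s \<bullet> g i) + 1 / (2 * L) * (g i \<bullet> g i)"
      using L unfolding power2_norm_eq_inner
      by (simp add: inner_diff_left inner_diff_right inner_commute field_simps)
    moreover have "t0 = c - 1 / \<rho> * (s \<bullet> s) - 1 / (2 * L) * (s \<bullet> s)"
      using L by (simp add: t0_def \<kappa>_def field_simps)
    ultimately show ?thesis by linarith
  qed
  show thesis
  proof (rule that[of t0 y0 s])
    show "(t0, y0) \<in> convex_feasible f L \<rho> xk I p"
      using cut0 by (simp add: convex_feasible_iff_cuts[OF assms(3)] y0(2) g_def)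
    show "(t0, y0, s) \<in> nonconvex_feasible f L I p"
      using cut0 second0 by (simp add: nonconvex_feasible_def g_def)
  next
    fix t y u
    assume "\<And>i. i \<in> I \<Longrightarrow>
      1 / (2 * L) * (norm (u - grad f (p i)))\<^sup>2 \<le> t - f (p i) - grad f (p i) \<bullet> (y - p i)"
    then have "c + (y - xk - (1 / L) *\<^sub>R u) \<bullet> s \<le> t - 1 / (2 * L) * (u \<bullet> u)"
      by (intro hull) (simp only: cut_iff[symmetric], simp only: g_def)
    from dual_lower_bound[OF L assms(3) this]
    have bound: "t0 + \<rho> / 2 * (norm (y0 - xk))\<^sup>2 + 1 / (2 * L) * (norm (u - s))\<^sup>2
        + \<rho> / 2 * (norm (y - xk + (1 / \<rho>) *\<^sub>R s))\<^sup>2 \<le> t + \<rho> / 2 * (norm (y - xk))\<^sup>2"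
      unfolding val \<kappa>_def .
    have nonneg: "0 \<le> 1 / (2 * L) * (norm (u - s))\<^sup>2"
      "0 \<le> \<rho> / 2 * (norm (y - xk + (1 / \<rho>) *\<^sub>R s))\<^sup>2"
      using L assms(3) by auto
    have "t = t0 \<and> y = y0"
      if le: "t + \<rho> / 2 * (norm (y - xk))\<^sup>2 \<le> t0 + \<rho> / 2 * (norm (y0 - xk))\<^sup>2"
    proof -
      have "\<rho> / 2 * (norm (y - xk + (1 / \<rho>) *\<^sub>R s))\<^sup>2 = 0"
        using bound nonneg le by linarith
      then have "y - xk + (1 / \<rho>) *\<^sub>R s = 0"
        using assms(3) by simp
      then have "y = y0"
        by (simp add: y0_def algebra_simps eq_neg_iff_add_eq_0)
      with bound nonneg le show ?thesis by auto
    qed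
    with bound nonneg show
      "t0 + \<rho> / 2 * (norm (y0 - xk))\<^sup>2 \<le> t + \<rho> / 2 * (norm (y - xk))\<^sup>2 \<and>
      (t + \<rho> / 2 * (norm (y - xk))\<^sup>2 \<le> t0 + \<rho> / 2 * (norm (y0 - xk))\<^sup>2 \<longrightarrow> t = t0 \<and> y = y0)"
      by auto
  qed
qed

lemma optimal_value_eq_minimum:
  assumes "z0 \<in> S" "\<And>z. z \<in> S \<Longrightarrow> \<phi> z0 \<le> \<phi> z"
  shows "optimal_value \<phi> S = ereal (\<phi> z0)"
  unfolding optimal_value_def
  using assms by (intro antisym INF_lower2[of z0] INF_greatest) auto

theorem theorem13:
  fixes f :: "real ^ 'n \<Rightarrow> real" and L \<rho> :: real and xk :: "real ^ 'n"
    and I :: "'i set" and p :: "'i \<Rightarrow> real ^ 'n"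
  assumes "convex_on UNIV f"
    and "L_smooth L f"
    and "\<rho> > 0"
    and "finite I" and "I \<noteq> {}"
  shows "optimal_value (nonconvex_objective \<rho> xk) (nonconvex_feasible f L I p)
           = optimal_value (convex_objective \<rho> xk) (convex_feasible f L \<rho> xk I p) \<and>
         (\<forall>t y.
           is_arg_min (convex_objective \<rho> xk) (\<lambda>z. z \<in> convex_feasible f L \<rho> xk I p) (t, y) \<longleftrightarrow>
           (\<exists>u. is_arg_min (nonconvex_objective \<rho> xk) (\<lambda>z. z \<in> nonconvex_feasible f L I p) (t, y, u)))"
proof -
  let ?C = "convex_feasible f L \<rho> xk I p" and ?N = "nonconvex_feasible f L I p"
  let ?obj = "\<lambda>t y. t + \<rho> / 2 * (norm (y - xk))\<^sup>2"
  obtain t0 y0 u0 where C0: "(t0, y0) \<in> ?C" and N0: "(t0, y0, u0) \<in> ?N" and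
    opt: "\<And>t y u. (\<And>i. i \<in> I \<Longrightarrow>
        1 / (2 * L) * (norm (u - grad f (p i)))\<^sup>2 \<le> t - f (p i) - grad f (p i) \<bullet> (y - p i)) \<Longrightarrow>
      ?obj t0 y0 \<le> ?obj t y \<and> (?obj t y \<le> ?obj t0 y0 \<longrightarrow> t = t0 \<and> y = y0)"
    by (rule common_optimum[OF assms, where xk = xk and p = p]) blast
  have C: "?obj t0 y0 \<le> ?obj t y \<and> (?obj t y \<le> ?obj t0 y0 \<longrightarrow> t = t0 \<and> y = y0)"
    if "(t, y) \<in> ?C" for t y
    by (rule opt[of "\<rho> *\<^sub>R (xk - y)"])
      (use that in \<open>simp add: convex_feasible_iff_cuts[OF assms(3)]\<close>)
  have N: "?obj t0 y0 \<le> ?obj t y \<and> (?obj t y \<le> ?obj t0 y0 \<longrightarrow> t = t0 \<and> y = y0)"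
    if "(t, y, u) \<in> ?N" for t y u
    by (rule opt[of u]) (use that in \<open>simp add: nonconvex_feasible_def\<close>)
  have "optimal_value (convex_objective \<rho> xk) ?C = ereal (?obj t0 y0)"
    using optimal_value_eq_minimum[OF C0, of "convex_objective \<rho> xk"] C
    by (auto simp: convex_objective_def)
  moreover have "optimal_value (nonconvex_objective \<rho> xk) ?N = ereal (?obj t0 y0)"
    using optimal_value_eq_minimum[OF N0, of "nonconvex_objective \<rho> xk"] N
    by (auto simp: nonconvex_objective_def)
  \<comment> \<open>In each program the optimal pairs \<open>(t, y)\<close> reduce to
    \<open>(t0, y0)\<close>, so the two optimality statements coincide.\<close>
  moreover have "is_arg_min (convex_objective \<rho> xk) (\<lambda>z. z \<in> ?C) (t, y) \<longleftrightarrow> t = t0 \<and> y = y0" for t y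
    using C C0 by (fastforce simp: is_arg_min_linorder convex_objective_def)
  moreover have "(\<exists>u. is_arg_min (nonconvex_objective \<rho> xk) (\<lambda>z. z \<in> ?N) (t, y, u))
      \<longleftrightarrow> t = t0 \<and> y = y0" for t y
    using N N0 by (fastforce simp: is_arg_min_linorder nonconvex_objective_def)
  ultimately show ?thesis by simp
qed

end
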